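(* Let $n,t$ be positive integers. A generic group of $\mathcal N_2(n,t)$ does not contain any abelian subgroup of rank $\left[\frac{2n+t^2+3t}{t+2}\right]+1$, where $[\cdot]$ denotes the integer part.
   Context: For a group $G$, $G'$ is the commutator subgroup and $I(G')=\{x\in G\mid x^k\in G'\text{ for some }k\ge 1\}$ the isolator of $G'$. $\operatorname{rk}$ is the (torsion-free) rank of an abelian group. $\mathcal N_2(n,t)$ is the set of all finitely generated torsion-free 2-step nilpotent groups $G$ with $\operatorname{rk}G'=t$ and $\operatorname{rk}G/I(G')=n$. Let $B_n(\mathbb Z)$ be the set of integer skew-symmetric (alternating) bilinear forms on $\mathbb Z^n$ with basis $a_1,\dots,a_n$, viewed as the subset of integer matrices in the space $B_n(\mathbb Q)$ of alternating bilinear forms on $\mathbb Q^n$. For a $t$-tuple $\Phi=(\varphi_1,\dots,\varphi_t)\in B_n(\mathbb Z)^t$, $G(\Phi)$ is the group of formal products $a_1^{k_1}\cdots a_n^{k_n}b_1^{l_1}\cdots b_t^{l_t}$ ($k_i,l_j\in\mathbb Z$) with multiplication $$a_1^{k_1}\cdots a_n^{k_n}b_1^{l_1}\cdots b_t^{l_t}\cdot a_1^{p_1}\cdots a_n^{p_n}b_1^{q_1}\cdots b_t^{q_t}=a_1^{k_1+p_1}\cdots a_n^{k_n+p_n}\prod_{m=1}^t b_m^{\,l_m+q_m+\sum_{i>j}k_ip_j\varphi_m(a_i,a_j)}.$$ Let $P_{n,t}\subset B_n(\mathbb Z)^t$ be the set of $t$-tuples of linearly independent forms. For $\Phi\in P_{n,t}$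 the group $G(\Phi)$ lies in $\mathcal N_2(n,t)$, and every group in $\mathcal N_2(n,t)$ is isomorphic to some such $G(\Phi)$. Generic: a generic group of $\mathcal N_2(n,t)$ has an (isomorphism-invariant) property $\mathcal A$ if the set of $\Phi\in P_{n,t}$ such that $G(\Phi)$ does not have $\mathcal A$ is contained in some proper Zariski-closed subset of the affine space $B_n(\mathbb Q)^t$. *)

theory Defs
  imports "Jordan_Normal_Form.Matrix" "HOL-Library.Extended_Nat"
begin

text \<open>A bilinear form \<open>\<phi>\<close> on the free module of rank \<open>n\<close> is represented by its matrix
  \<open>A $$ (i, j) = \<phi>(a\<^sub>i, a\<^sub>j)\<close>, so that \<open>\<phi>(x, y) = x \<bullet> (A *\<^sub>v y)\<close>. The basis is indexed from 0.\<close>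

definition alternating_forms :: "nat \<Rightarrow> 'a::comm_ring_1 mat set" where
  "alternating_forms n =
     {A \<in> carrier_mat n n. \<forall>x\<in>carrier_vec n. x \<bullet> (A *\<^sub>v x) = 0}"

definition form_tuples :: "nat \<Rightarrow> nat \<Rightarrow> 'a::comm_ring_1 mat list set" where
  "form_tuples n t = {\<Phi>. length \<Phi> = t \<and> set \<Phi> \<subseteq> alternating_forms n}"

definition rat_tuple :: "int mat list \<Rightarrow> rat mat list" where
  "rat_tuple \<Phi> = map (map_mat of_int) \<Phi>"

definition lin_indep_tuple :: "nat \<Rightarrow> nat \<Rightarrow> rat mat list \<Rightarrow> bool" where
  "lin_indep_tuple n t \<Phi> \<longleftrightarrow>
     (\<forall>c :: nat \<Rightarrow> rat.
        (\<forall>i<n. \<forall>j<n. (\<Sum>m<t. c m * (\<Phi> ! m) $$ (i, j)) = 0) \<longrightarrow> (\<forall>m<t. c m = 0))"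

definition indep_form_tuples :: "nat \<Rightarrow> nat \<Rightarrow> int mat list set" where
  "indep_form_tuples n t = {\<Phi> \<in> form_tuples n t. lin_indep_tuple n t (rat_tuple \<Phi>)}"

text \<open>The pair \<open>(k, l)\<close> stands for the formal product of the \<open>a\<^sub>i\<close> to the powers \<open>k $ i\<close>
  followed by the \<open>b\<^sub>m\<close> to the powers \<open>l $ m\<close>.\<close>

definition form_group :: "nat \<Rightarrow> nat \<Rightarrow> int mat list \<Rightarrow> (int vec \<times> int vec) monoid" where
  "form_group n t \<Phi> =
     \<lparr>carrier = carrier_vec n \<times> carrier_vec t,
      mult = (\<lambda>(k, l) (p, q).
        (k + p, vec t (\<lambda>m. l $ m + q $ m + (\<Sum>i<n. \<Sum>j<i. k $ i * p $ j * (\<Phi> ! m) $$ (i, j))))),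
      one = (0\<^sub>v n, 0\<^sub>v t)\<rparr>"

lemma group_form_group: "group (form_group n t \<Phi>)"
proof (rule groupI, goal_cases)
  case (1 x y)
  then show ?case by (auto simp: form_group_def)
next
  case 2
  then show ?case by (auto simp: form_group_def)
next
  case (3 x y z)
  then show ?case
    by (auto simp: form_group_def algebra_simps sum.distrib intro!: eq_vecI)
next
  case (4 x)
  then show ?case by (auto simp: form_group_def intro!: eq_vecI)
next
  case (5 x)
  obtain k l where x: "x = (k, l)" by (cases x)
  let ?q = "vec t (\<lambda>m. - l $ m + (\<Sum>i<n. \<Sum>j<i. k $ i * k $ j * (\<Phi> ! m) $$ (i, j)))"
  have "(- k, ?q) \<in> carrier (form_group n t \<Phi>)"
    using 5 x by (auto simp: form_group_def)
  moreover have "(- k, ?q) \<otimes>\<^bsub>form_group n t \<Phi>\<^esub> x = \<one>\<^bsub>form_group n t \<Phi>\<^esub>"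
    using 5 x by (auto simp: form_group_def sum_negf intro!: eq_vecI)
  ultimately show ?case by blast
qed

definition int_independent :: "('a, 'b) monoid_scheme \<Rightarrow> 'a set \<Rightarrow> bool" where
  "int_independent A S \<longleftrightarrow>
     finite S \<and> S \<subseteq> carrier A \<and>
     (\<forall>c :: 'a \<Rightarrow> int. (\<Otimes>\<^bsub>A\<^esub>x\<in>S. x [^]\<^bsub>A\<^esub> c x) = \<one>\<^bsub>A\<^esub> \<longrightarrow> (\<forall>x\<in>S. c x = 0))"

text \<open>The torsion-free rank; only meaningful for an abelian group.\<close>

definition abelian_rank :: "('a, 'b) monoid_scheme \<Rightarrow> enat" where
  "abelian_rank A = (SUP S\<in>{S. int_independent A S}. enat (card S))"

definition has_abelian_subgroup_of_rank :: "nat \<Rightarrow> ('a, 'b) monoid_scheme \<Rightarrow> bool" where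
  "has_abelian_subgroup_of_rank r G \<longleftrightarrow>
     (\<exists>H. subgroup H G \<and> comm_group (G\<lparr>carrier := H\<rparr>) \<and>
          abelian_rank (G\<lparr>carrier := H\<rparr>) = enat r)"

lemma int_independent_iso:
  assumes A: "comm_group A" and B: "comm_group B" and h: "h \<in> iso A B"
    and S: "int_independent A S"
  shows "int_independent B (h ` S)" "card (h ` S) = card S"
proof -
  interpret A: comm_group A by fact
  interpret B: comm_group B by fact
  have hom: "h \<in> hom A B" and inj: "inj_on h (carrier A)" and im: "h ` carrier A = carrier B"
    using h by (auto simp: iso_def bij_betw_def)
  interpret h: group_hom A B h
    using hom by unfold_locales
  have SA: "S \<subseteq> carrier A" and fin: "finite S"
    using S by (auto simp: int_independent_def)
  have injS: "inj_on h S"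
    using inj SA by (rule inj_on_subset)
  then show "card (h ` S) = card S" by (rule card_image)
  have "c y = 0"
    if c: "(\<Otimes>\<^bsub>B\<^esub>x\<in>h ` S. x [^]\<^bsub>B\<^esub> c x) = \<one>\<^bsub>B\<^esub>" and y: "y \<in> h ` S" for c :: "_ \<Rightarrow> int" and y
  proof -
    have "h (\<Otimes>\<^bsub>A\<^esub>x\<in>S. x [^]\<^bsub>A\<^esub> c (h x)) = (\<Otimes>\<^bsub>B\<^esub>x\<in>S. h (x [^]\<^bsub>A\<^esub> c (h x)))"
      using fin SA by (induction S) (auto simp: Pi_iff subset_iff)
    also have "\<dots> = (\<Otimes>\<^bsub>B\<^esub>x\<in>S. h x [^]\<^bsub>B\<^esub> c (h x))"
      using SA by (intro B.finprod_cong') (auto simp: h.hom_int_pow)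
    also have "\<dots> = (\<Otimes>\<^bsub>B\<^esub>x\<in>h ` S. x [^]\<^bsub>B\<^esub> c x)"
      using SA by (intro B.finprod_reindex[symmetric, OF _ injS]) auto
    also have "\<dots> = h \<one>\<^bsub>A\<^esub>" using c by simp
    finally have "(\<Otimes>\<^bsub>A\<^esub>x\<in>S. x [^]\<^bsub>A\<^esub> c (h x)) = \<one>\<^bsub>A\<^esub>"
      by (rule inj_onD[OF inj]) (use SA in \<open>auto intro!: A.finprod_closed\<close>)
    then show ?thesis
      using S y by (auto simp: int_independent_def dest!: spec[of _ "c \<circ> h"])
  qed
  then show "int_independent B (h ` S)"
    using SA fin im by (auto simp: int_independent_def)
qed

lemma abelian_rank_iso:
  assumes "comm_group A" "comm_group B" "A \<cong> B"
  shows "abelian_rank A = abelian_rank B"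
proof -
  obtain h where h: "h \<in> iso A B"
    using assms(3) by (auto simp: is_iso_def)
  obtain g where g: "g \<in> iso B A"
    using group.iso_sym[OF comm_group.axioms(2)[OF assms(1)] assms(3)] by (auto simp: is_iso_def)
  show ?thesis
    unfolding abelian_rank_def
  proof (rule antisym; rule SUP_least)
    fix S assume "S \<in> {S. int_independent A S}"
    then show "enat (card S) \<le> (SUP S\<in>{S. int_independent B S}. enat (card S))"
      using int_independent_iso[OF assms(1,2) h, of S]
      by (intro SUP_upper2[of "h ` S"]) auto
  next
    fix S assume "S \<in> {S. int_independent B S}"
    then show "enat (card S) \<le> (SUP S\<in>{S. int_independent A S}. enat (card S))"
      using int_independent_iso[OF assms(2,1) g, of S]
      by (intro SUP_upper2[of "g ` S"]) auto
  qed
qed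

lemma has_abelian_subgroup_of_rank_iso:
  assumes G: "group G" and G': "group G'" and iso: "G \<cong> G'"
    and "has_abelian_subgroup_of_rank r G"
  shows "has_abelian_subgroup_of_rank r G'"
proof -
  obtain h where h: "h \<in> iso G G'" using iso by (auto simp: is_iso_def)
  obtain H where H: "subgroup H G" and comm: "comm_group (G\<lparr>carrier := H\<rparr>)"
    and rk: "abelian_rank (G\<lparr>carrier := H\<rparr>) = enat r"
    using assms by (auto simp: has_abelian_subgroup_of_rank_def)
  interpret h: group_hom G G' h
    using G G' h by (simp add: group_hom_def group_hom_axioms_def iso_def)
  have K: "subgroup (h ` H) G'" using H by (rule h.subgroup_img_is_subgroup)
  have HG: "H \<subseteq> carrier G" using H by (rule subgroup.subset)
  have "h \<in> iso (G\<lparr>carrier := H\<rparr>) (G'\<lparr>carrier := h ` H\<rparr>)"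
    using h HG by (auto simp: iso_def hom_def bij_betw_def inj_on_def subset_iff)
  then have isoHK: "G\<lparr>carrier := H\<rparr> \<cong> G'\<lparr>carrier := h ` H\<rparr>" by (auto simp: is_iso_def)
  have "group (G'\<lparr>carrier := h ` H\<rparr>)"
    using K G' by (rule subgroup.subgroup_is_group)
  then have commK: "comm_group (G'\<lparr>carrier := h ` H\<rparr>)"
    using comm_group.iso_imp_comm_group[OF comm isoHK] by (simp add: group.is_monoid)
  show ?thesis
    unfolding has_abelian_subgroup_of_rank_def
    using K commK abelian_rank_iso[OF comm commK isoHK] rk by auto
qed

text \<open>Polynomial functions in the matrix entries of a tuple. On alternating tuples all entries
  are, up to sign, zero or one of the independent coordinates with \<open>i < j\<close>, so these restrict
  to exactly the polynomial functions on the affine space \<open>form_tuples n t\<close>.\<close>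

inductive form_polynomial :: "nat \<Rightarrow> nat \<Rightarrow> (rat mat list \<Rightarrow> rat) \<Rightarrow> bool" for n t where
  const: "form_polynomial n t (\<lambda>\<Phi>. c)"
| coord: "m < t \<Longrightarrow> i < n \<Longrightarrow> j < n \<Longrightarrow> form_polynomial n t (\<lambda>\<Phi>. (\<Phi> ! m) $$ (i, j))"
| add: "form_polynomial n t f \<Longrightarrow> form_polynomial n t g \<Longrightarrow> form_polynomial n t (\<lambda>\<Phi>. f \<Phi> + g \<Phi>)"
| mult: "form_polynomial n t f \<Longrightarrow> form_polynomial n t g \<Longrightarrow> form_polynomial n t (\<lambda>\<Phi>. f \<Phi> * g \<Phi>)"

definition zariski_closed :: "nat \<Rightarrow> nat \<Rightarrow> rat mat list set \<Rightarrow> bool" where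
  "zariski_closed n t Z \<longleftrightarrow>
     (\<exists>F. (\<forall>f\<in>F. form_polynomial n t f) \<and> Z = {\<Phi> \<in> form_tuples n t. \<forall>f\<in>F. f \<Phi> = 0})"

text \<open>A generic finitely generated torsion-free 2-step nilpotent group \<open>G\<close> with
  \<open>rk G' = t\<close> and \<open>rk G/I(G') = n\<close> has property \<open>\<A>\<close>. Every such group is isomorphic to some
  \<open>form_group n t \<Phi>\<close> with \<open>\<Phi> \<in> indep_form_tuples n t\<close>; \<open>\<A>\<close> is understood to be invariant
  under isomorphism.\<close>

definition generic_group_has ::
  "nat \<Rightarrow> nat \<Rightarrow> ((int vec \<times> int vec) monoid \<Rightarrow> bool) \<Rightarrow> bool" where
  "generic_group_has n t \<A> \<longleftrightarrow>
     (\<exists>Z. zariski_closed n t Z \<and> Z \<subset> form_tuples n t \<and>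
          rat_tuple ` {\<Phi> \<in> indep_form_tuples n t. \<not> \<A> (form_group n t \<Phi>)} \<subseteq> Z)"

end

theory Submission
  imports Defs "HOL-Computational_Algebra.Polynomial"
begin

text \<open>Let \<open>d = [(2n + t) / (t + 2)] + 1\<close>, so that the rank in question is \<open>t + d\<close>. An abelian subgroup
  of that rank projects to a subgroup of rank at least \<open>d\<close> of \<open>\<int>\<^sup>n\<close> on which all forms vanish. In
  reduced echelon form with pivot set \<open>S\<close>, a \<open>d\<close>-dimensional subspace has \<open>d (n - d)\<close> parameters,
  and isotropy expresses the \<open>t d (d - 1) / 2\<close> entries of the forms with both indices in \<open>S\<close> as
  polynomials in these parameters and the remaining entries. Since
  \<open>d (n - d) < t d (d - 1) / 2\<close>, the tuples with a common isotropic subspace lie in finitely many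
  polynomial images of affine spaces of smaller dimension, so a counting argument yields a nonzero
  polynomial vanishing on all of them.\<close>

section \<open>Gauss-Jordan elimination over a field\<close>

text \<open>Rows are indexed by \<open>A\<close>, columns by \<open>B\<close>; \<open>S\<close> is
  the set of pivot columns and \<open>w\<close> records the row operations. Induction on the rows:
  independence leaves a nonzero entry in the new row after elimination at the old pivots, and its
  column becomes the next pivot.\<close>

lemma ex_reduced_echelon:
  fixes v :: "'a \<Rightarrow> 'b \<Rightarrow> 'k::field"
  assumes "finite A"
    and "\<forall>c. (\<forall>b\<in>B. (\<Sum>a\<in>A. c a * v a b) = 0) \<longrightarrow> (\<forall>a\<in>A. c a = 0)"
  shows "\<exists>S w. S \<subseteq> B \<and> finite S \<and> card S = card A \<and>
           (\<forall>s\<in>S. \<forall>s'\<in>S. (\<Sum>a\<in>A. w s a * v a s') = of_bool (s = s'))"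
  using assms
proof (induction A rule: finite_induct)
  case empty
  then show ?case by (intro exI[of _ "{}"]) auto
next
  case (insert x A)
  have "c a = 0" if "\<forall>b\<in>B. (\<Sum>a\<in>A. c a * v a b) = 0" "a \<in> A" for c a
  proof -
    have "(\<Sum>a\<in>A. (c(x := 0)) a * v a b) = (\<Sum>a\<in>A. c a * v a b)" for b
      using insert.hyps by (intro sum.cong) auto
    then show ?thesis
      using insert.prems[THEN spec, of "c(x := 0)"] that insert.hyps by (auto split: if_splits)
  qed
  then obtain S w where S: "S \<subseteq> B" "finite S" "card S = card A"
    and w: "\<And>s s'. s \<in> S \<Longrightarrow> s' \<in> S \<Longrightarrow> (\<Sum>a\<in>A. w s a * v a s') = of_bool (s = s')"
    using insert.IH by blast
  define r where "r a = (if a = x then 1 else - (\<Sum>s\<in>S. v x s * w s a))" for a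
  define R where "R b = (\<Sum>a\<in>insert x A. r a * v a b)" for b
  have R: "R b = v x b - (\<Sum>s\<in>S. v x s * (\<Sum>a\<in>A. w s a * v a b))" for b
  proof -
    have "R b = v x b + (\<Sum>a\<in>A. r a * v a b)"
      using insert.hyps by (simp add: R_def r_def)
    also have "(\<Sum>a\<in>A. r a * v a b) = (\<Sum>a\<in>A. - (\<Sum>s\<in>S. v x s * w s a * v a b))"
      using insert.hyps by (intro sum.cong) (auto simp: r_def sum_distrib_right)
    also have "\<dots> = - (\<Sum>s\<in>S. v x s * (\<Sum>a\<in>A. w s a * v a b))"
      by (simp add: sum_negf sum_distrib_left mult.assoc sum.swap[of _ A S])
    finally show ?thesis by simp
  qed
  have R0: "R s' = 0" if "s' \<in> S" for s'
  proof -
    have "(\<Sum>s\<in>S. v x s * (\<Sum>a\<in>A. w s a * v a s')) = (\<Sum>s\<in>S. if s = s' then v x s else 0)"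
      using w that by (intro sum.cong) auto
    then show ?thesis using S that by (simp add: R)
  qed
  have "\<exists>q\<in>B. R q \<noteq> 0"
    using insert.prems[THEN spec, of r] by (auto simp: R_def r_def)
  then obtain q where q: "q \<in> B" "R q \<noteq> 0" by blast
  have qS: "q \<notin> S" using q R0 by auto
  define U where "U s = (\<Sum>a\<in>A. w s a * v a q)" for s
  \<comment> \<open>Row \<open>q\<close> is scaled to have entry 1 at \<open>q\<close>, and
    \<open>U s\<close>, the entry of row \<open>s\<close> in column \<open>q\<close>, is cleared.
    The value of \<open>w s\<close> at \<open>x\<close> is reset to 0, because the induction
    hypothesis constrains \<open>w\<close> on \<open>A\<close> only.\<close>
  define w' where
    "w' s a = (if s = q then r a / R q else (if a = x then 0 else w s a) - U s * r a / R q)" for s a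
  have w'q: "(\<Sum>a\<in>insert x A. w' q a * v a b) = R b / R q" for b
    by (simp add: w'_def R_def sum_divide_distrib del: sum.insert)
  have w's: "(\<Sum>a\<in>insert x A. w' s a * v a b) = (\<Sum>a\<in>A. w s a * v a b) - U s * R b / R q"
    if "s \<noteq> q" for s b
  proof -
    have "(\<Sum>a\<in>insert x A. w' s a * v a b) =
        (\<Sum>a\<in>insert x A. (if a = x then 0 else w s a) * v a b) -
        (\<Sum>a\<in>insert x A. U s * (r a * v a b) / R q)"
      unfolding sum_subtractf[symmetric] using that
      by (intro sum.cong) (auto simp: w'_def field_simps)
    also have "(\<Sum>a\<in>insert x A. (if a = x then 0 else w s a) * v a b) = (\<Sum>a\<in>A. w s a * v a b)"
      using insert.hyps by (auto intro!: sum.cong)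
    also have "(\<Sum>a\<in>insert x A. U s * (r a * v a b) / R q) = U s * R b / R q"
      unfolding R_def by (simp add: sum_distrib_left sum_divide_distrib del: sum.insert)
    finally show ?thesis .
  qed
  have "\<forall>s\<in>insert q S. \<forall>s'\<in>insert q S. (\<Sum>a\<in>insert x A. w' s a * v a s') = of_bool (s = s')"
  proof (intro ballI)
    fix s s' assume s: "s \<in> insert q S" "s' \<in> insert q S"
    show "(\<Sum>a\<in>insert x A. w' s a * v a s') = of_bool (s = s')"
    proof (cases "s = q")
      case True
      then show ?thesis
        unfolding True w'q using s q qS R0 by auto
    next
      case False
      then show ?thesis
        unfolding w's[OF False] using s q qS R0 w by (auto simp: U_def[symmetric])
    qed
  qed
  then show ?case
    using S q qS insert.hyps by (intro exI[of _ "insert q S"] exI[of _ w']) auto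
qed

text \<open>Without a solution the rows would be independent, and the echelon form would place
  \<open>card A\<close> pivots inside \<open>B\<close>.\<close>

lemma ex_nontrivial_solution:
  fixes v :: "'a \<Rightarrow> 'b \<Rightarrow> 'k::field"
  assumes "finite A" "finite B" "card B < card A"
  obtains c a where "a \<in> A" "c a \<noteq> 0" "\<And>b. b \<in> B \<Longrightarrow> (\<Sum>a\<in>A. c a * v a b) = 0"
proof (rule ccontr)
  assume "\<not> thesis"
  with that have "\<forall>c. (\<forall>b\<in>B. (\<Sum>a\<in>A. c a * v a b) = 0) \<longrightarrow> (\<forall>a\<in>A. c a = 0)"
    by blast
  from ex_reduced_echelon[OF assms(1) this] obtain S where "S \<subseteq> B" "card S = card A"
    by blast
  with assms show False using card_mono[of B S] by auto
qed

section \<open>Polynomial functions of bounded degree and counting on grids\<close>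

text \<open>Only the values of \<open>y\<close> on \<open>V\<close> matter, and the degree is bounded in each variable separately.\<close>

definition sep_degree_le :: "'v set \<Rightarrow> nat \<Rightarrow> (('v \<Rightarrow> 'k::comm_ring_1) \<Rightarrow> 'k) \<Rightarrow> bool" where
  "sep_degree_le V k f \<longleftrightarrow>
     (\<forall>y y'. (\<forall>v\<in>V. y v = y' v) \<longrightarrow> f y = f y') \<and>
     (\<forall>y v. \<exists>p. degree p \<le> k \<and> (\<forall>x. f (y(v := x)) = poly p x))"

lemma sep_degree_le_mono: "sep_degree_le V k f \<Longrightarrow> k \<le> l \<Longrightarrow> sep_degree_le V l f"
  unfolding sep_degree_le_def by (meson order_trans)

lemma sep_degree_le_const: "sep_degree_le V k (\<lambda>y. c)"
  unfolding sep_degree_le_def by (auto intro!: exI[of _ "[:c:]"])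

lemma sep_degree_le_var:
  assumes "v \<in> V"
  shows "sep_degree_le V 1 (\<lambda>y. y v)"
  unfolding sep_degree_le_def
proof (intro conjI allI impI)
  fix y :: "'a \<Rightarrow> 'b" and u
  show "\<exists>p. degree p \<le> 1 \<and> (\<forall>x. (y(u := x)) v = poly p x)"
    by (cases "u = v") (auto intro: exI[of _ "[:0, 1:]"] exI[of _ "[:y v:]"])
qed (use assms in auto)

lemma sep_degree_le_add:
  assumes "sep_degree_le V k f" "sep_degree_le V k g"
  shows "sep_degree_le V k (\<lambda>y. f y + g y)"
  unfolding sep_degree_le_def
proof (intro conjI allI impI)
  fix y :: "'a \<Rightarrow> 'b" and u
  obtain p q where "degree p \<le> k" "\<forall>x. f (y(u := x)) = poly p x"
    "degree q \<le> k" "\<forall>x. g (y(u := x)) = poly q x"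
    using assms unfolding sep_degree_le_def by metis
  then show "\<exists>p. degree p \<le> k \<and> (\<forall>x. f (y(u := x)) + g (y(u := x)) = poly p x)"
    by (intro exI[of _ "p + q"]) (auto intro: degree_add_le)
next
  fix y y' :: "'a \<Rightarrow> 'b" assume "\<forall>v\<in>V. y v = y' v"
  then show "f y + g y = f y' + g y'"
    using assms unfolding sep_degree_le_def by metis
qed

lemma sep_degree_le_mult:
  assumes "sep_degree_le V k f" "sep_degree_le V l g"
  shows "sep_degree_le V (k + l) (\<lambda>y. f y * g y)"
  unfolding sep_degree_le_def
proof (intro conjI allI impI)
  fix y :: "'a \<Rightarrow> 'b" and u
  obtain p q where "degree p \<le> k" "\<forall>x. f (y(u := x)) = poly p x"
    "degree q \<le> l" "\<forall>x. g (y(u := x)) = poly q x"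
    using assms unfolding sep_degree_le_def by metis
  then show "\<exists>p. degree p \<le> k + l \<and> (\<forall>x. f (y(u := x)) * g (y(u := x)) = poly p x)"
    by (intro exI[of _ "p * q"]) (auto intro: order_trans[OF degree_mult_le])
next
  fix y y' :: "'a \<Rightarrow> 'b" assume "\<forall>v\<in>V. y v = y' v"
  then show "f y * g y = f y' * g y'"
    using assms unfolding sep_degree_le_def by metis
qed

lemma sep_degree_le_uminus:
  assumes "sep_degree_le V k f"
  shows "sep_degree_le V k (\<lambda>y. - f y)"
  using sep_degree_le_mult[OF sep_degree_le_const[of V 0 "-1"] assms] by simp

lemma sep_degree_le_diff:
  assumes "sep_degree_le V k f" "sep_degree_le V k g"
  shows "sep_degree_le V k (\<lambda>y. f y - g y)"
  using sep_degree_le_add[OF assms(1) sep_degree_le_uminus[OF assms(2)]] by simp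

lemma sep_degree_le_sum:
  assumes "\<And>i. i \<in> I \<Longrightarrow> sep_degree_le V k (f i)"
  shows "sep_degree_le V k (\<lambda>y. \<Sum>i\<in>I. f i y)"
  using assms
  by (induction I rule: infinite_finite_induct) (auto intro: sep_degree_le_const sep_degree_le_add)

lemma sep_degree_le_prod:
  assumes "\<And>i. i \<in> I \<Longrightarrow> sep_degree_le V k (f i)"
  shows "sep_degree_le V (card I * k) (\<lambda>y. \<Prod>i\<in>I. f i y)"
  using assms
  by (induction I rule: infinite_finite_induct) (auto intro: sep_degree_le_const sep_degree_le_mult)

text \<open>Variables are released from the grid one at a time. Each time a univariate polynomial of
  degree at most \<open>k\<close> has \<open>k + 1\<close> roots, distinct in characteristic 0, so
  it is zero.\<close>

lemma sep_degree_le_eq_0: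
  fixes f :: "('v \<Rightarrow> 'k::field_char_0) \<Rightarrow> 'k"
  assumes f: "sep_degree_le V k f" and V: "finite V"
    and grid: "\<And>\<beta>. \<beta> \<in> V \<rightarrow>\<^sub>E {..k} \<Longrightarrow> f (\<lambda>v. of_nat (\<beta> v)) = 0"
  shows "f y = 0"
proof -
  \<comment> \<open>\<open>W\<close> is the set of released variables; on the rest of
    \<open>V\<close>, \<open>y\<close> still takes grid values.\<close>
  have "f y = 0" if "W \<subseteq> V" "\<forall>v\<in>V - W. y v \<in> of_nat ` {..k}" for W and y
    using finite_subset[OF that(1) V] that
  proof (induction W arbitrary: y rule: finite_induct)
    case empty
    then have "\<exists>b. \<forall>v\<in>V. b v \<in> {..k} \<and> y v = of_nat (b v)"
      by (intro bchoice) auto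
    then obtain b where b: "\<And>v. v \<in> V \<Longrightarrow> b v \<le> k" "\<And>v. v \<in> V \<Longrightarrow> y v = of_nat (b v)"
      by auto
    have "f y = f (\<lambda>v. of_nat (restrict b V v))"
      using f b by (auto simp: sep_degree_le_def)
    then show ?case using grid[of "restrict b V"] b by auto
  next
    case (insert w W)
    obtain p where p: "degree p \<le> k" "\<And>x. f (y(w := x)) = poly p x"
      using f unfolding sep_degree_le_def by metis
    have "poly p (of_nat i) = 0" if "i \<le> k" for i
      unfolding p(2)[symmetric] using insert.prems that insert.hyps by (intro insert.IH) auto
    then have "of_nat ` {..k} \<subseteq> {x. poly p x = 0}" by auto
    moreover have "card (of_nat ` {..k} :: 'k set) = Suc k"
      by (subst card_image) (auto simp: inj_on_def)
    ultimately have "p = 0"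
      using card_mono[OF poly_roots_finite, of p "of_nat ` {..k}"] card_poly_roots_bound[of p] p(1)
      by (cases "p = 0") auto
    then show ?case using p(2)[of "y w"] by simp
  qed
  from this[of V y] show ?thesis by auto
qed

text \<open>Products over the axes of the numerators of the Lagrange basis for the nodes 0, ...,
  \<open>D - 1\<close>. Only the zero pattern on the grid matters, so there is no
  normalisation.\<close>

definition grid_lagrange :: "'i set \<Rightarrow> nat \<Rightarrow> ('i \<Rightarrow> nat) \<Rightarrow> ('i \<Rightarrow> 'k::comm_ring_1) \<Rightarrow> 'k" where
  "grid_lagrange I D \<alpha> x = (\<Prod>i\<in>I. \<Prod>k\<in>{..<D} - {\<alpha> i}. x i - of_nat k)"

lemma grid_lagrange_of_nat_eq_0_iff:
  assumes "finite I" "\<alpha> \<in> I \<rightarrow>\<^sub>E {..<D}" "\<gamma> \<in> I \<rightarrow>\<^sub>E {..<D}"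
  shows "grid_lagrange I D \<alpha> (\<lambda>i. of_nat (\<gamma> i) :: 'k::field_char_0) = 0 \<longleftrightarrow> \<alpha> \<noteq> \<gamma>"
proof -
  have "grid_lagrange I D \<alpha> (\<lambda>i. of_nat (\<gamma> i) :: 'k) = 0 \<longleftrightarrow> (\<exists>i\<in>I. \<alpha> i \<noteq> \<gamma> i)"
    using assms by (auto simp: grid_lagrange_def PiE_iff) metis+
  also have "\<dots> \<longleftrightarrow> \<alpha> \<noteq> \<gamma>"
    using assms(2,3) by (auto intro: PiE_ext)
  finally show ?thesis .
qed

text \<open>Lagrange polynomials of a grid with \<open>D\<close> points per axis span a space of dimension
  \<open>D ^ card I\<close>; pulled back along a polynomial map from fewer variables they lie in a space of
  dimension \<open>O(D ^ (card I - 1))\<close>, so for large \<open>D\<close> some combination vanishes on all the images.\<close>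

lemma ex_polynomial_vanishing_on_images:
  fixes g :: "'c \<Rightarrow> 'i \<Rightarrow> ('v \<Rightarrow> 'k::field_char_0) \<Rightarrow> 'k"
  assumes I: "finite I" and C: "finite C" and V: "\<And>S. S \<in> C \<Longrightarrow> finite (V S)"
    and less: "\<And>S. S \<in> C \<Longrightarrow> card (V S) < card I"
    and g: "\<And>S i. S \<in> C \<Longrightarrow> i \<in> I \<Longrightarrow> sep_degree_le (V S) e (g S i)"
  obtains D :: nat and c :: "('i \<Rightarrow> nat) \<Rightarrow> 'k" and \<alpha>
  where "\<alpha> \<in> I \<rightarrow>\<^sub>E {..<D}" "c \<alpha> \<noteq> 0"
    "\<And>S y. S \<in> C \<Longrightarrow> (\<Sum>\<alpha>\<in>I \<rightarrow>\<^sub>E {..<D}. c \<alpha> * grid_lagrange I D \<alpha> (\<lambda>i. g S i y)) = 0"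
proof -
  define N where "N = card I"
  \<comment> \<open>Chosen so that one extra power of \<open>D\<close> outweighs all constants when
    \<open>D ^ N\<close> coefficients are compared with at most
    \<open>card C * ((N * e + 1) * D) ^ (N - 1)\<close> conditions.\<close>
  define D where "D = Suc (card C * (N * e + 1) ^ N)"
  \<comment> \<open>Bounds the degree in each variable of a pulled-back Lagrange polynomial:
    \<open>N\<close> groups of at most \<open>D\<close> factors, each of degree at most
    \<open>e\<close>.\<close>
  define K where "K = N * (D * e)"
  define A where "A = (I \<rightarrow>\<^sub>E {..<D})"
  define B where "B = (SIGMA S:C. V S \<rightarrow>\<^sub>E {..K})"
  \<comment> \<open>One linear condition on the coefficients for each \<open>S\<close> and each grid
    point \<beta>. By the degree bound, \<open>K + 1\<close> values per axis force vanishing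
    everywhere.\<close>
  define v where "v \<alpha> = (\<lambda>(S, \<beta>). grid_lagrange I D \<alpha> (\<lambda>i. g S i (\<lambda>v. of_nat (\<beta> v))))"
    for \<alpha> :: "'i \<Rightarrow> nat"
  have fin: "finite A" "finite B"
    using I C V by (auto simp: A_def B_def intro!: finite_PiE)
  have cardA: "card A = D ^ N"
    using I by (simp add: A_def N_def card_PiE)
  have "card B = (\<Sum>S\<in>C. Suc K ^ card (V S))"
    using C V by (simp add: B_def card_SigmaI finite_PiE card_PiE)
  also have "\<dots> < D ^ N"
  \<comment> \<open>With \<open>C\<close> empty there are no conditions and \<open>D = 1\<close>, so
    the claim is 0 < 1; otherwise \<open>less\<close> makes \<open>N\<close> positive.\<close>
  proof (cases "C = {}")
    case False
    then have N: "N > 0" using less by (auto simp: N_def)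
    have "(\<Sum>S\<in>C. Suc K ^ card (V S)) \<le> (\<Sum>S\<in>C. ((N * e + 1) * D) ^ (N - 1))"
    proof (rule sum_mono)
      fix S assume S: "S \<in> C"
      have "Suc K ^ card (V S) \<le> Suc K ^ (N - 1)"
        using less[OF S] by (intro power_increasing) (auto simp: N_def)
      also have "\<dots> \<le> ((N * e + 1) * D) ^ (N - 1)"
        by (intro power_mono) (auto simp: K_def D_def algebra_simps)
      finally show "Suc K ^ card (V S) \<le> ((N * e + 1) * D) ^ (N - 1)" .
    qed
    also have "\<dots> = card C * (N * e + 1) ^ (N - 1) * D ^ (N - 1)"
      by (simp only: power_mult_distrib sum_constant of_nat_id mult.assoc)
    also have "\<dots> \<le> card C * (N * e + 1) ^ N * D ^ (N - 1)"
      by (intro mult_le_mono1 mult_le_mono2 power_increasing) auto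
    also have "\<dots> < D * D ^ (N - 1)"
      by (intro mult_strict_right_mono) (auto simp: D_def)
    also have "\<dots> = D ^ N"
      using N by (metis power_eq_if neq0_conv)
    finally show ?thesis .
  qed (auto simp: D_def)
  finally have "card B < card A" by (simp add: cardA)
  from ex_nontrivial_solution[OF fin this, of v] obtain c \<alpha> where c: "\<alpha> \<in> A" "c \<alpha> \<noteq> 0"
    "\<And>b. b \<in> B \<Longrightarrow> (\<Sum>\<alpha>\<in>A. c \<alpha> * v \<alpha> b) = 0"
    by blast
  show ?thesis
  proof (rule that)
    fix S y assume S: "S \<in> C"
    have "sep_degree_le (V S) K (\<lambda>y. c \<alpha> * grid_lagrange I D \<alpha> (\<lambda>i. g S i y))" for \<alpha>
    proof -
      have *: "sep_degree_le (V S) (D * e) (\<lambda>y. \<Prod>k\<in>{..<D} - {\<alpha> i}. g S i y - of_nat k)"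
        if "i \<in> I" for i
      proof (rule sep_degree_le_mono[OF sep_degree_le_prod])
        show "card ({..<D} - {\<alpha> i}) * e \<le> D * e"
          using card_mono[of "{..<D}" "{..<D} - {\<alpha> i}"] by simp
      qed (use g S that in \<open>auto intro: sep_degree_le_diff sep_degree_le_const\<close>)
      show ?thesis
        using sep_degree_le_mult[OF sep_degree_le_const[of _ 0 "c \<alpha>"] sep_degree_le_prod[OF *]]
        by (simp add: grid_lagrange_def K_def N_def)
    qed
    then have "sep_degree_le (V S) K (\<lambda>y. \<Sum>\<alpha>\<in>A. c \<alpha> * grid_lagrange I D \<alpha> (\<lambda>i. g S i y))"
      by (rule sep_degree_le_sum)
    then show "(\<Sum>\<alpha>\<in>I \<rightarrow>\<^sub>E {..<D}. c \<alpha> * grid_lagrange I D \<alpha> (\<lambda>i. g S i y)) = 0"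
      unfolding A_def[symmetric]
    proof (rule sep_degree_le_eq_0[OF _ V[OF S]])
      fix \<beta> assume "\<beta> \<in> V S \<rightarrow>\<^sub>E {..K}"
      then show "(\<Sum>\<alpha>\<in>A. c \<alpha> * grid_lagrange I D \<alpha> (\<lambda>i. g S i (\<lambda>v. of_nat (\<beta> v)))) = 0"
        using c(3)[of "(S, \<beta>)"] S by (simp add: B_def v_def)
    qed
  qed (use c in \<open>auto simp: A_def\<close>)
qed

section \<open>Alternating forms and their isotropic vectors\<close>

text \<open>Arguments are functions instead of vectors, so that linear combinations carry no
  dimension conditions.\<close>

definition form_value :: "nat \<Rightarrow> 'a::comm_ring_1 mat \<Rightarrow> (nat \<Rightarrow> 'a) \<Rightarrow> (nat \<Rightarrow> 'a) \<Rightarrow> 'a" where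
  "form_value n A x y = (\<Sum>i<n. \<Sum>j<n. x i * A $$ (i, j) * y j)"

lemma form_value_scalar_prod:
  assumes "A \<in> carrier_mat n n" "x \<in> carrier_vec n" "y \<in> carrier_vec n"
  shows "x \<bullet> (A *\<^sub>v y) = form_value n A (\<lambda>i. x $ i) (\<lambda>i. y $ i)"
  using assms
  by (auto simp: form_value_def scalar_prod_def sum_distrib_left lessThan_atLeast0 mult.assoc
      intro!: sum.cong)

lemma form_value_add:
  "form_value n A (\<lambda>i. x i + x' i) y = form_value n A x y + form_value n A x' y"
  "form_value n A x (\<lambda>i. y i + y' i) = form_value n A x y + form_value n A x y'"
  by (simp_all add: form_value_def algebra_simps sum.distrib)

lemma form_value_sum:
  "form_value n A (\<lambda>i. \<Sum>a\<in>X. c a * f a i) (\<lambda>j. \<Sum>b\<in>Y. d b * g b j) =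
     (\<Sum>a\<in>X. \<Sum>b\<in>Y. c a * d b * form_value n A (f a) (g b))"
proof -
  have "form_value n A (\<lambda>i. \<Sum>a\<in>X. c a * f a i) (\<lambda>j. \<Sum>b\<in>Y. d b * g b j) =
      (\<Sum>i<n. \<Sum>j<n. \<Sum>a\<in>X. \<Sum>b\<in>Y. c a * d b * (f a i * A $$ (i, j) * g b j))"
    unfolding form_value_def sum_distrib_right
    by (intro sum.cong refl) (simp only: sum_distrib_left mult_ac)
  also have "\<dots> = (\<Sum>i<n. \<Sum>a\<in>X. \<Sum>j<n. \<Sum>b\<in>Y. c a * d b * (f a i * A $$ (i, j) * g b j))"
    by (intro sum.cong refl sum.swap)
  also have "\<dots> = (\<Sum>i<n. \<Sum>a\<in>X. \<Sum>b\<in>Y. \<Sum>j<n. c a * d b * (f a i * A $$ (i, j) * g b j))"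
    by (intro sum.cong refl sum.swap)
  also have "\<dots> = (\<Sum>a\<in>X. \<Sum>i<n. \<Sum>b\<in>Y. \<Sum>j<n. c a * d b * (f a i * A $$ (i, j) * g b j))"
    by (rule sum.swap)
  also have "\<dots> = (\<Sum>a\<in>X. \<Sum>b\<in>Y. \<Sum>i<n. \<Sum>j<n. c a * d b * (f a i * A $$ (i, j) * g b j))"
    by (intro sum.cong refl sum.swap)
  finally show ?thesis by (simp add: form_value_def sum_distrib_left)
qed

lemma form_value_unit:
  assumes "i < n" "j < n"
  shows "form_value n A (\<lambda>k. of_bool (k = i)) (\<lambda>k. of_bool (k = j)) = A $$ (i, j)"
proof -
  have "form_value n A (\<lambda>k. of_bool (k = i)) (\<lambda>k. of_bool (k = j)) =
      (\<Sum>k<n. if k = i then (\<Sum>l<n. if l = j then A $$ (k, l) else 0) else 0)"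
    unfolding form_value_def by (intro sum.cong refl) (auto intro!: sum.cong)
  then show ?thesis using assms by simp
qed

text \<open>Polarisation at two unit vectors gives skew-symmetry. Conversely, swapping the summation
  indices shows that \<open>form_value n A x x\<close> equals its own negative, hence is 0 in
  characteristic 0.\<close>

lemma alternating_forms_iff:
  fixes A :: "'a::{idom, ring_char_0} mat"
  shows "A \<in> alternating_forms n \<longleftrightarrow>
    A \<in> carrier_mat n n \<and> (\<forall>i<n. \<forall>j<n. A $$ (i, j) = - A $$ (j, i))"
proof (intro iffI conjI allI impI)
  fix i j assume A: "A \<in> alternating_forms n" and ij: "i < n" "j < n"
  have zero: "form_value n A f f = 0" for f
  proof -
    have "form_value n A f f = form_value n A (\<lambda>i. vec n f $ i) (\<lambda>i. vec n f $ i)"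
      by (simp add: form_value_def)
    also have "\<dots> = vec n f \<bullet> (A *\<^sub>v vec n f)"
      using A by (subst form_value_scalar_prod) (auto simp: alternating_forms_def)
    also have "\<dots> = 0"
      using A by (auto simp: alternating_forms_def)
    finally show ?thesis .
  qed
  let ?e = "\<lambda>i k. of_bool (k = i) :: 'a"
  have "form_value n A (?e i) (?e j) + form_value n A (?e j) (?e i) = 0"
    using zero[of "\<lambda>k. ?e i k + ?e j k"] zero[of "?e i"] zero[of "?e j"]
    by (simp add: form_value_add add.commute)
  then show "A $$ (i, j) = - A $$ (j, i)"
    using ij by (simp add: form_value_unit eq_neg_iff_add_eq_0)
next
  assume A: "A \<in> carrier_mat n n \<and> (\<forall>i<n. \<forall>j<n. A $$ (i, j) = - A $$ (j, i))"
  have "form_value n A x x = 0" for x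
  proof -
    have "form_value n A x x = (\<Sum>j<n. \<Sum>i<n. x i * A $$ (i, j) * x j)"
      unfolding form_value_def by (rule sum.swap)
    also have "\<dots> = (\<Sum>j<n. \<Sum>i<n. - (x j * A $$ (j, i) * x i))"
    proof (intro sum.cong refl)
      fix i j assume "j \<in> {..<n}" "i \<in> {..<n}"
      then have "A $$ (i, j) = - A $$ (j, i)" using A by blast
      then show "x i * A $$ (i, j) * x j = - (x j * A $$ (j, i) * x i)"
        by (simp only:) (simp add: mult_ac)
    qed
    also have "\<dots> = - form_value n A x x"
      by (simp add: form_value_def sum_negf)
    finally show ?thesis by (simp add: equal_neg_zero)
  qed
  with A show "A \<in> alternating_forms n"
    by (auto simp: alternating_forms_def form_value_scalar_prod)
qed (auto simp: alternating_forms_def)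

text \<open>On the columns in \<open>S\<close> the frame is the identity matrix. Hence in the
  expansion of the form at \<open>u s\<close> and \<open>u s'\<close> the entry at
  \<open>(s, s')\<close> has coefficient 1, and every other entry that occurs has an index in
  \<open>T\<close>; isotropy can be solved for the former.\<close>

lemma isotropic_chart:
  fixes A :: "'a::comm_ring_1 mat"
  assumes S: "S \<subseteq> {..<n}"
    and u: "\<And>s s'. s \<in> S \<Longrightarrow> s' \<in> S \<Longrightarrow> u s s' = of_bool (s = s')"
    and iso: "form_value n A (u s) (u s') = 0" and s: "s \<in> S" "s' \<in> S"
  defines "T \<equiv> {..<n} - S"
  shows "A $$ (s, s') = - ((\<Sum>j\<in>T. u s' j * A $$ (s, j)) + (\<Sum>i\<in>T. u s i * A $$ (i, s')) +
    (\<Sum>i\<in>T. \<Sum>j\<in>T. u s i * u s' j * A $$ (i, j)))"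
proof -
  have finS: "finite S" using S finite_subset by blast
  have split: "(\<Sum>i<n. u s i * F i) = F s + (\<Sum>i\<in>T. u s i * F i)" if "s \<in> S" for s and F :: "nat \<Rightarrow> 'a"
  proof -
    have "(\<Sum>i<n. u s i * F i) = (\<Sum>i\<in>T. u s i * F i) + (\<Sum>i\<in>S. u s i * F i)"
      unfolding T_def using S by (intro sum.subset_diff) auto
    also have "(\<Sum>i\<in>S. u s i * F i) = (\<Sum>i\<in>S. if i = s then F i else 0)"
      using u that by (intro sum.cong) auto
    finally show ?thesis using that finS by simp
  qed
  have "form_value n A (u s) (u s') = (\<Sum>i<n. u s i * (\<Sum>j<n. u s' j * A $$ (i, j)))"
    by (simp add: form_value_def sum_distrib_left mult_ac)
  also have "\<dots> = A $$ (s, s') + ((\<Sum>j\<in>T. u s' j * A $$ (s, j)) + (\<Sum>i\<in>T. u s i * A $$ (i, s')) +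
    (\<Sum>i\<in>T. \<Sum>j\<in>T. u s i * u s' j * A $$ (i, j)))"
    unfolding split[OF s(2)] split[OF s(1)]
    by (simp add: distrib_left sum.distrib sum_distrib_left mult.assoc)
  finally show ?thesis
    unfolding eq_neg_iff_add_eq_0 using iso by (simp only:)
qed

section \<open>Dimension count for tuples with a common isotropic subspace\<close>

lemma form_polynomial_sum:
  assumes "\<And>i. i \<in> I \<Longrightarrow> form_polynomial n t (f i)"
  shows "form_polynomial n t (\<lambda>\<Phi>. \<Sum>i\<in>I. f i \<Phi>)"
  using assms
  by (induction I rule: infinite_finite_induct) (auto intro: form_polynomial.intros)

lemma form_polynomial_prod:
  assumes "\<And>i. i \<in> I \<Longrightarrow> form_polynomial n t (f i)"
  shows "form_polynomial n t (\<lambda>\<Phi>. \<Prod>i\<in>I. f i \<Phi>)"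
  using assms
  by (induction I rule: infinite_finite_induct) (auto intro: form_polynomial.intros)

lemma card_less_pairs:
  fixes S :: "nat set"
  assumes "finite S"
  shows "2 * card {(i, j). i \<in> S \<and> j \<in> S \<and> i < j} + card S = card S * card S"
proof -
  let ?L = "{(i, j). i \<in> S \<and> j \<in> S \<and> i < j}" and ?G = "{(i, j). i \<in> S \<and> j \<in> S \<and> j < i}"
  let ?D = "(\<lambda>i. (i, i)) ` S"
  have fin: "finite ?L" "finite ?G"
    using assms by (auto intro: finite_subset[of _ "S \<times> S"])
  have "card ?G = card (prod.swap ` ?L)"
    by (rule arg_cong[of _ _ card]) force
  also have "\<dots> = card ?L" by (rule card_image) simp
  finally have G: "card ?G = card ?L" .
  have "card S * card S = card (S \<times> S)" by (simp add: card_cartesian_product)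
  also have "S \<times> S = (?L \<union> ?G) \<union> ?D" by auto
  also have "card \<dots> = card ?L + card ?G + card ?D"
    using assms fin by (subst card_Un_disjoint; (subst card_Un_disjoint)?) auto
  also have "card ?D = card S" by (rule card_image) (auto simp: inj_on_def)
  finally show ?thesis using G by simp
qed

text \<open>A reduced echelon basis, with pivot set \<open>S\<close>, of a common isotropic
  subspace. The identity block on the pivots makes the vectors independent, so the dimension is
  \<open>card S\<close>.\<close>

definition isotropic_frame ::
  "nat \<Rightarrow> nat \<Rightarrow> 'a::comm_ring_1 mat list \<Rightarrow> nat set \<Rightarrow> (nat \<Rightarrow> nat \<Rightarrow> 'a) \<Rightarrow> bool" where
  "isotropic_frame n t \<Phi> S u \<longleftrightarrow> S \<subseteq> {..<n} \<and>
     (\<forall>s\<in>S. \<forall>s'\<in>S. u s s' = of_bool (s = s')) \<and>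
     (\<forall>m<t. \<forall>s\<in>S. \<forall>s'\<in>S. form_value n (\<Phi> ! m) (u s) (u s') = 0)"

text \<open>Each pivot set gives a polynomial chart with fewer than \<open>card I\<close> variables,
  so counting on the grid yields one polynomial that vanishes on all charts. The tuple
  \<open>\<Phi>\<^sub>0\<close> witnesses that it is nonzero on alternating tuples.\<close>

lemma ex_form_polynomial_vanishing_on_isotropic:
  fixes n t d :: nat
  assumes d: "2 * n + t < d * (t + 2)"
  obtains f \<Phi>\<^sub>0 where "form_polynomial n t f" "\<Phi>\<^sub>0 \<in> form_tuples n t" "f \<Phi>\<^sub>0 \<noteq> 0"
    "\<And>\<Phi> S u. \<Phi> \<in> form_tuples n t \<Longrightarrow> isotropic_frame n t \<Phi> S u \<Longrightarrow> card S = d \<Longrightarrow> f \<Phi> = 0"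
proof -
  define I where "I = {..<t} \<times> {(i, j). i < n \<and> j < n \<and> i < j}"
  define C where "C = {S. S \<subseteq> {..<n} \<and> card S = d}"
  define L where "L S = {..<t} \<times> {(i, j). i \<in> S \<and> j \<in> S \<and> i < j}" for S :: "nat set"
  \<comment> \<open>The tag \<open>t\<close> in the first component marks the echelon parameters; form entries have tags below \<open>t\<close>.\<close>
  define V where "V S = (I - L S) \<union> {t} \<times> (S \<times> ({..<n} - S))" for S
  \<comment> \<open>Rebuilds the skew-symmetric matrices from their coordinates above the
    diagonal.\<close>
  define z where "z m i j y = (if i < j then y (m, i, j) else if j < i then - y (m, j, i) else 0)"
    for m i j :: nat and y :: "nat \<times> nat \<times> nat \<Rightarrow> rat"
  \<comment> \<open>The chart with pivot set \<open>S\<close>: entries with both indices in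
    \<open>S\<close> are given by \<open>isotropic_chart\<close>, with \<open>y (t, s, b)\<close>
    for \<open>u s b\<close>; the other entries are free.\<close>
  define g where "g S = (\<lambda>(m, i, j) y. if i \<in> S \<and> j \<in> S then
      - ((\<Sum>b\<in>{..<n} - S. y (t, j, b) * z m i b y) + (\<Sum>a\<in>{..<n} - S. y (t, i, a) * z m a j y) +
         (\<Sum>a\<in>{..<n} - S. \<Sum>b\<in>{..<n} - S. y (t, i, a) * y (t, j, b) * z m a b y))
      else y (m, i, j))" for S
  have "finite {(i, j). i < n \<and> j < n \<and> i < j}"
    by (rule finite_subset[of _ "{..<n} \<times> {..<n}"]) auto
  then have finI: "finite I" by (simp add: I_def)
  have finC: "finite C" by (simp add: C_def)
  have finV: "finite (V S)" if "S \<in> C" for S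
    using that finI finite_subset[of S "{..<n}"] by (auto simp: V_def C_def)
  have cardV: "card (V S) < card I" if "S \<in> C" for S
  proof -
    have S: "S \<subseteq> {..<n}" "card S = d" "finite S"
      using that finite_subset[of S "{..<n}"] by (auto simp: C_def)
    have LI: "L S \<subseteq> I" using S by (auto simp: L_def I_def)
    have "d \<le> n" using S card_mono[of "{..<n}" S] by simp
    have "d > 0" using d by (cases d) auto
    define q where "q = card {(i, j). i \<in> S \<and> j \<in> S \<and> i < j}"
    have "2 * q + d = d * d"
      using card_less_pairs[OF S(3)] S by (simp add: q_def)
    then have "t * (2 * q + d) = t * (d * d)" by simp
    then have "2 * card (L S) + t * d = t * (d * d)"
      by (simp add: L_def card_cartesian_product q_def algebra_simps)
    \<comment> \<open>The hypothesis multiplied by \<open>d\<close>: there are fewer echelon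
      parameters than eliminated entries.\<close>
    moreover have "2 * (d * (n - d)) + t * d < t * (d * d)"
    proof -
      have "2 * (n - d) + t < t * d"
        using d \<open>d \<le> n\<close> by (simp add: algebra_simps)
      then have "d * (2 * (n - d) + t) < d * (t * d)"
        using \<open>d > 0\<close> by (rule mult_strict_left_mono)
      then show ?thesis by (simp add: algebra_simps)
    qed
    ultimately have "d * (n - d) < card (L S)" by linarith
    moreover have "card (V S) \<le> (card I - card (L S)) + d * (n - d)"
    proof -
      have "card (V S) \<le> card (I - L S) + card ({t} \<times> (S \<times> ({..<n} - S)))"
        unfolding V_def by (rule card_Un_le)
      then show ?thesis
        using S LI finI finite_subset[OF LI]
        by (simp add: card_Diff_subset card_cartesian_product)
    qed
    moreover have "card (L S) \<le> card I" using card_mono[OF finI LI] .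
    ultimately show ?thesis by linarith
  qed
  \<comment> \<open>Entries with both indices in \<open>S\<close> are not variables in
    \<open>V S\<close>, whence the condition that some index lies outside.\<close>
  have deg_z: "sep_degree_le (V S) 1 (z m a b)"
    if "m < t" "a < n" "b < n" "a \<notin> S \<or> b \<notin> S" for S m a b
    using that unfolding z_def
    by (cases a b rule: linorder_cases)
      (auto intro!: sep_degree_le_var sep_degree_le_uminus sep_degree_le_const[of _ 1]
        simp: V_def I_def L_def simp del: One_nat_def)
  have deg_y: "sep_degree_le (V S) 1 (\<lambda>y :: nat \<times> nat \<times> nat \<Rightarrow> rat. y (t, s, a))"
    if "s \<in> S" "a \<in> {..<n} - S" for S s a
    using that by (intro sep_degree_le_var) (auto simp: V_def)
  have deg_g: "sep_degree_le (V S) 3 (g S i)" if S: "S \<in> C" and i: "i \<in> I" for S i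
  proof -
    obtain m a b where i_eq: "i = (m, a, b)" by (cases i)
    have mab: "m < t" "a < n" "b < n" "a < b" using i by (auto simp: i_eq I_def)
    show ?thesis
    proof (cases "a \<in> S \<and> b \<in> S")
      case False
      then have "sep_degree_le (V S) 1 (\<lambda>y :: nat \<times> nat \<times> nat \<Rightarrow> rat. y (m, a, b))"
        using mab by (intro sep_degree_le_var) (auto simp: V_def I_def L_def)
      then show ?thesis
        using False by (auto simp: g_def i_eq intro: sep_degree_le_mono)
    next
      case True
      have 1: "sep_degree_le (V S) 3 (\<lambda>y. y (t, s, c) * z m a' b' y)"
        if "s \<in> S" "c \<in> {..<n} - S" "a' < n" "b' < n" "a' \<notin> S \<or> b' \<notin> S" for s c a' b'
        by (rule sep_degree_le_mono[OF sep_degree_le_mult[OF deg_y deg_z]]) (use that mab in auto)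
      have 2: "sep_degree_le (V S) 3 (\<lambda>y. y (t, a, a') * y (t, b, b') * z m a' b' y)"
        if "a' \<in> {..<n} - S" "b' \<in> {..<n} - S" for a' b'
        by (rule sep_degree_le_mono[OF sep_degree_le_mult[OF sep_degree_le_mult[OF deg_y deg_y] deg_z]])
          (use that mab True in auto)
      have "sep_degree_le (V S) 3 (\<lambda>y. - ((\<Sum>b'\<in>{..<n} - S. y (t, b, b') * z m a b' y) +
          (\<Sum>a'\<in>{..<n} - S. y (t, a, a') * z m a' b y) +
          (\<Sum>a'\<in>{..<n} - S. \<Sum>b'\<in>{..<n} - S. y (t, a, a') * y (t, b, b') * z m a' b' y)))"
        using mab True
        by (intro sep_degree_le_uminus sep_degree_le_add sep_degree_le_sum 1 2) auto
      then show ?thesis using True by (simp add: g_def i_eq)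
    qed
  qed
  obtain D c \<alpha> where \<alpha>: "\<alpha> \<in> I \<rightarrow>\<^sub>E {..<D}" "c \<alpha> \<noteq> 0"
    and vanish: "\<And>S y. S \<in> C \<Longrightarrow>
      (\<Sum>\<alpha>\<in>I \<rightarrow>\<^sub>E {..<D}. c \<alpha> * grid_lagrange I D \<alpha> (\<lambda>i. g S i y)) = 0"
    by (rule ex_polynomial_vanishing_on_images[OF finI finC finV cardV deg_g]) (assumption | rule that)+
  define f where "f \<Phi> = (\<Sum>\<alpha>\<in>I \<rightarrow>\<^sub>E {..<D}. c \<alpha> *
    grid_lagrange I D \<alpha> (\<lambda>(m, i, j). (\<Phi> ! m) $$ (i, j)))" for \<Phi> :: "rat mat list"
  \<comment> \<open>The tuple whose coordinates are the grid point \<alpha>. Only the Lagrange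
    polynomial of \<alpha> is nonzero there, so a single term of \<open>f\<close> survives.\<close>
  define \<Phi>\<^sub>0 where "\<Phi>\<^sub>0 = map (\<lambda>m. mat n n (\<lambda>(i, j). z m i j (\<lambda>v. of_nat (\<alpha> v)))) [0..<t]"
  show ?thesis
  proof (rule that)
    have "form_polynomial n t (\<lambda>\<Phi>. (\<lambda>(m, i, j). (\<Phi> ! m) $$ (i, j)) v - of_nat k)"
      if "v \<in> I" for v k
    proof -
      obtain m i j where v: "v = (m, i, j)" by (cases v)
      have "form_polynomial n t (\<lambda>\<Phi>. (\<Phi> ! m) $$ (i, j) + (- of_nat k))"
        using that by (intro form_polynomial.intros) (auto simp: v I_def)
      then show ?thesis by (simp add: v)
    qed
    then show "form_polynomial n t f"
      unfolding f_def grid_lagrange_def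
      by (intro form_polynomial_sum form_polynomial.mult form_polynomial.const form_polynomial_prod)
    show "\<Phi>\<^sub>0 \<in> form_tuples n t"
      by (auto simp: \<Phi>\<^sub>0_def form_tuples_def alternating_forms_iff z_def)
    have "grid_lagrange I D \<beta> (\<lambda>(m, i, j). (\<Phi>\<^sub>0 ! m) $$ (i, j)) =
        (grid_lagrange I D \<beta> (\<lambda>v. of_nat (\<alpha> v)) :: rat)" for \<beta>
      unfolding grid_lagrange_def by (intro prod.cong refl) (auto simp: \<Phi>\<^sub>0_def I_def z_def)
    then have "f \<Phi>\<^sub>0 = (\<Sum>\<beta>\<in>I \<rightarrow>\<^sub>E {..<D}.
        if \<beta> = \<alpha> then c \<alpha> * grid_lagrange I D \<alpha> (\<lambda>v. of_nat (\<alpha> v)) else 0)"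
      unfolding f_def using \<alpha> finI
      by (intro sum.cong refl) (auto simp: grid_lagrange_of_nat_eq_0_iff)
    also have "\<dots> = c \<alpha> * grid_lagrange I D \<alpha> (\<lambda>v. of_nat (\<alpha> v))"
      using \<alpha> finI by (simp add: finite_PiE)
    finally show "f \<Phi>\<^sub>0 \<noteq> 0"
      using \<alpha> finI by (simp add: grid_lagrange_of_nat_eq_0_iff)
  next
    fix \<Phi> :: "rat mat list" and S and u :: "nat \<Rightarrow> nat \<Rightarrow> rat"
    assume \<Phi>: "\<Phi> \<in> form_tuples n t" and frame: "isotropic_frame n t \<Phi> S u" and card: "card S = d"
    then have S: "S \<subseteq> {..<n}" "card S = d"
      and u: "\<And>s s'. s \<in> S \<Longrightarrow> s' \<in> S \<Longrightarrow> u s s' = of_bool (s = s')"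
      and iso: "\<And>m s s'. m < t \<Longrightarrow> s \<in> S \<Longrightarrow> s' \<in> S \<Longrightarrow> form_value n (\<Phi> ! m) (u s) (u s') = 0"
      by (auto simp: isotropic_frame_def)
    \<comment> \<open>The parameter point that the chart sends to \<Phi>: form entries under tags
      below \<open>t\<close>, the frame under tag \<open>t\<close>.\<close>
    define y where "y = (\<lambda>(m, i, j). if m < t then (\<Phi> ! m) $$ (i, j) else u i j)"
    have alt: "(\<Phi> ! m) $$ (i, j) = - (\<Phi> ! m) $$ (j, i)" if "m < t" "i < n" "j < n" for m i j
    proof -
      have "\<Phi> ! m \<in> alternating_forms n"
        using \<Phi> that by (auto simp: form_tuples_def subset_iff)
      then show ?thesis using that unfolding alternating_forms_iff by blast
    qed
    have z: "z m i j y = (\<Phi> ! m) $$ (i, j)" if "m < t" "i < n" "j < n" for m i j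
      using alt[OF that] that
      by (cases i j rule: linorder_cases) (auto simp: z_def y_def)
    have y: "y (t, a, b) = u a b" for a b
      by (simp add: y_def)
    have gS: "g S v y = (\<lambda>(m, i, j). (\<Phi> ! m) $$ (i, j)) v" if "v \<in> I" for v
    proof -
      obtain m i j where v_eq: "v = (m, i, j)" by (cases v)
      then have v: "v = (m, i, j)" "m < t" "i < n" "j < n"
        using \<open>v \<in> I\<close> by (auto simp: I_def)
      show ?thesis
      proof (cases "i \<in> S \<and> j \<in> S")
        case True
        show ?thesis
          using isotropic_chart[OF S(1) u iso[OF v(2) conjunct1[OF True] conjunct2[OF True]]
              conjunct1[OF True] conjunct2[OF True]] True v
          by (simp add: g_def z y cong: sum.cong_simp)
      qed (use v in \<open>auto simp: g_def y_def\<close>)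
    qed
    have "grid_lagrange I D \<beta> (\<lambda>(m, i, j). (\<Phi> ! m) $$ (i, j)) = grid_lagrange I D \<beta> (\<lambda>i. g S i y)"
      for \<beta>
      unfolding grid_lagrange_def by (intro prod.cong refl) (simp only: gS)
    then have "f \<Phi> = (\<Sum>\<alpha>\<in>I \<rightarrow>\<^sub>E {..<D}. c \<alpha> * grid_lagrange I D \<alpha> (\<lambda>i. g S i y))"
      by (simp only: f_def)
    also have "\<dots> = 0" using S by (intro vanish) (auto simp: C_def)
    finally show "f \<Phi> = 0" .
  qed
qed

section \<open>Abelian subgroups of the form groups\<close>

lemma sum_square_split:
  fixes F :: "nat \<Rightarrow> nat \<Rightarrow> 'a::comm_monoid_add"
  shows "(\<Sum>i<n. \<Sum>j<n. F i j) = (\<Sum>i<n. \<Sum>j<i. F i j) + (\<Sum>i<n. \<Sum>j<i. F j i) + (\<Sum>i<n. F i i)"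
proof (induction n)
  case (Suc n)
  have "(\<Sum>i<Suc n. \<Sum>j<Suc n. F i j) = (\<Sum>i<n. \<Sum>j<n. F i j) + (\<Sum>i<n. F i n) + (\<Sum>j<n. F n j) + F n n"
    by (simp add: sum.distrib add.assoc add.left_commute)
  then show ?case unfolding Suc.IH by (simp add: add.assoc add.commute add.left_commute)
qed simp

text \<open>The right-hand side is the difference of a central exponent between the two products of
  elements with coordinates \<open>x\<close> and \<open>y\<close>. Skew-symmetry kills the diagonal
  of the double sum and turns the half above it into the subtracted term.\<close>

lemma form_value_eq_commutator:
  fixes A :: "int mat"
  assumes "A \<in> alternating_forms n"
  shows "form_value n A x y =
    (\<Sum>i<n. \<Sum>j<i. x i * y j * A $$ (i, j)) - (\<Sum>i<n. \<Sum>j<i. y i * x j * A $$ (i, j))"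
proof -
  have A: "A $$ (i, j) = - A $$ (j, i)" if "i < n" "j < n" for i j
    using assms that unfolding alternating_forms_iff by blast
  have diag: "A $$ (i, i) = 0" if "i < n" for i
    using A[OF that that] by simp
  have "(\<Sum>i<n. \<Sum>j<i. x j * A $$ (j, i) * y i) = (\<Sum>i<n. \<Sum>j<i. - (y i * x j * A $$ (i, j)))"
  proof (intro sum.cong refl)
    fix i j assume "i \<in> {..<n}" "j \<in> {..<i}"
    then have "A $$ (j, i) = - A $$ (i, j)" by (intro A) auto
    then show "x j * A $$ (j, i) * y i = - (y i * x j * A $$ (i, j))"
      by (simp only:) (simp add: mult_ac)
  qed
  then show ?thesis
    unfolding form_value_def sum_square_split
    by (simp add: diag sum_negf mult_ac)
qed

lemma (in group) additive_int_pow: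
  fixes h :: "'a \<Rightarrow> int"
  assumes h: "\<And>x y. x \<in> carrier G \<Longrightarrow> y \<in> carrier G \<Longrightarrow> h (x \<otimes> y) = h x + h y"
    and x: "x \<in> carrier G"
  shows "h (x [^] (k :: int)) = k * h x"
proof -
  have one: "h \<one> = 0" using h[of \<one> \<one>] by simp
  have nat: "h (x [^] (m :: nat)) = int m * h x" for m
    using x by (induction m) (auto simp: h one algebra_simps)
  show ?thesis
  proof (cases k)
    case (nonneg m)
    then show ?thesis using nat[of m] by (simp add: int_pow_int)
  next
    case (neg m)
    have "h (x [^] Suc m) + h (inv (x [^] Suc m)) = 0"
      using h[of "x [^] Suc m" "inv (x [^] Suc m)"] x one
      by (simp del: nat_pow_Suc)
    moreover have "x [^] k = inv (x [^] Suc m)"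
      unfolding neg using x by (simp only: int_pow_neg int_pow_int)
    ultimately have "h (x [^] k) = - h (x [^] Suc m)"
      by (simp only: add_eq_0_iff)
    then show ?thesis unfolding nat neg by (simp add: algebra_simps)
  qed
qed

lemma (in comm_group) additive_finprod_int_pow:
  fixes h :: "'a \<Rightarrow> int" and c :: "'a \<Rightarrow> int"
  assumes h: "\<And>x y. x \<in> carrier G \<Longrightarrow> y \<in> carrier G \<Longrightarrow> h (x \<otimes> y) = h x + h y"
    and S: "finite S" "S \<subseteq> carrier G"
  shows "h (\<Otimes>x\<in>S. x [^] c x) = (\<Sum>x\<in>S. c x * h x)"
  using S
proof (induction S rule: finite_induct)
  case empty
  then show ?case using h[of \<one> \<one>] by simp
next
  case (insert x S)
  then have "(\<lambda>x. x [^] c x) \<in> S \<rightarrow> carrier G" by auto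
  with insert show ?case
    by (simp add: h additive_int_pow[OF h] finprod_closed)
qed

text \<open>On an abelian subgroup the coordinates of the central part become additive after
  subtracting half of the quadratic form of the cocycle; doubling keeps them integral.\<close>

definition straightened_coord :: "nat \<Rightarrow> int mat list \<Rightarrow> int vec \<times> int vec \<Rightarrow> nat + nat \<Rightarrow> int" where
  "straightened_coord n \<Phi> x b = (case b of Inl i \<Rightarrow> fst x $ i
     | Inr m \<Rightarrow> 2 * snd x $ m - (\<Sum>i<n. \<Sum>j<i. fst x $ i * fst x $ j * (\<Phi> ! m) $$ (i, j)))"

text \<open>The two products have central coordinates that differ only in the order of the cocycle's
  arguments. Commuting makes the cocycle symmetric on the pair, and the form is its
  antisymmetrisation.\<close>

lemma form_group_commute:
  assumes "\<Phi> \<in> form_tuples n t" "m < t"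
    and "x \<otimes>\<^bsub>form_group n t \<Phi>\<^esub> y = y \<otimes>\<^bsub>form_group n t \<Phi>\<^esub> x"
  shows "form_value n (\<Phi> ! m) (($) (fst x)) (($) (fst y)) = 0"
    and "(\<Sum>i<n. \<Sum>j<i. fst x $ i * fst y $ j * (\<Phi> ! m) $$ (i, j)) =
         (\<Sum>i<n. \<Sum>j<i. fst y $ i * fst x $ j * (\<Phi> ! m) $$ (i, j))"
proof -
  have "snd (x \<otimes>\<^bsub>form_group n t \<Phi>\<^esub> y) $ m = snd (y \<otimes>\<^bsub>form_group n t \<Phi>\<^esub> x) $ m"
    using assms(3) by simp
  then show *: "(\<Sum>i<n. \<Sum>j<i. fst x $ i * fst y $ j * (\<Phi> ! m) $$ (i, j)) =
         (\<Sum>i<n. \<Sum>j<i. fst y $ i * fst x $ j * (\<Phi> ! m) $$ (i, j))"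
    using assms(2) by (simp add: form_group_def split_beta)
  have "\<Phi> ! m \<in> alternating_forms n"
    using assms by (auto simp: form_tuples_def subset_iff)
  then show "form_value n (\<Phi> ! m) (($) (fst x)) (($) (fst y)) = 0"
    using * by (simp add: form_value_eq_commutator)
qed

text \<open>The quadratic form at \<open>k + p\<close> contains both mixed cocycle terms. They agree
  for commuting elements, so together they cancel the doubled cocycle of the product.\<close>

lemma straightened_coord_mult:
  assumes "\<Phi> \<in> form_tuples n t" "b \<in> Inl ` {..<n} \<union> Inr ` {..<t}"
    and xy: "x \<in> carrier (form_group n t \<Phi>)" "y \<in> carrier (form_group n t \<Phi>)"
    and comm: "x \<otimes>\<^bsub>form_group n t \<Phi>\<^esub> y = y \<otimes>\<^bsub>form_group n t \<Phi>\<^esub> x"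
  shows "straightened_coord n \<Phi> (x \<otimes>\<^bsub>form_group n t \<Phi>\<^esub> y) b =
    straightened_coord n \<Phi> x b + straightened_coord n \<Phi> y b"
proof -
  obtain k l p q where x: "x = (k, l)" and y: "y = (p, q)" by (cases x, cases y)
  have kp: "k \<in> carrier_vec n" "p \<in> carrier_vec n" using xy by (auto simp: x y form_group_def)
  show ?thesis
  proof (cases b)
    case (Inl i)
    then show ?thesis using assms(2) kp by (auto simp: x y straightened_coord_def form_group_def)
  next
    case (Inr m)
    then have m: "m < t" using assms(2) by auto
    have "(\<Sum>i<n. \<Sum>j<i. (k + p) $ i * (k + p) $ j * (\<Phi> ! m) $$ (i, j)) =
        (\<Sum>i<n. \<Sum>j<i. k $ i * k $ j * (\<Phi> ! m) $$ (i, j) + k $ i * p $ j * (\<Phi> ! m) $$ (i, j) +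
          p $ i * k $ j * (\<Phi> ! m) $$ (i, j) + p $ i * p $ j * (\<Phi> ! m) $$ (i, j))"
      using kp by (intro sum.cong refl) (auto simp: algebra_simps)
    then show ?thesis
      using form_group_commute(2)[OF assms(1) m comm] m
      by (simp add: Inr x y straightened_coord_def form_group_def sum.distrib)
  qed
qed

text \<open>Vanishing \<open>Inl\<close> coordinates remove the quadratic correction, so an
  \<open>Inr\<close> coordinate is then twice the central exponent.\<close>

lemma straightened_coord_eq_0:
  assumes "x \<in> carrier (form_group n t \<Phi>)"
    and "\<And>b. b \<in> Inl ` {..<n} \<union> Inr ` {..<t} \<Longrightarrow> straightened_coord n \<Phi> x b = 0"
  shows "x = \<one>\<^bsub>form_group n t \<Phi>\<^esub>"
proof -
  obtain k l where x: "x = (k, l)" by (cases x)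
  have kl: "k \<in> carrier_vec n" "l \<in> carrier_vec t" using assms by (auto simp: x form_group_def)
  have k: "k $ i = 0" if "i < n" for i
    using assms(2)[of "Inl i"] that by (simp add: straightened_coord_def x)
  have "l $ m = 0" if "m < t" for m
    using assms(2)[of "Inr m"] that by (simp add: straightened_coord_def x k)
  with k kl show ?thesis by (auto simp: x form_group_def intro!: eq_vecI)
qed

lemma ex_common_denominator:
  fixes c :: "'a \<Rightarrow> rat"
  assumes "finite S"
  obtains q :: int and c' :: "'a \<Rightarrow> int" where "q > 0" "\<And>x. x \<in> S \<Longrightarrow> of_int q * c x = of_int (c' x)"
proof -
  have "\<exists>q :: int. q > 0 \<and> (\<forall>x\<in>S. \<exists>z :: int. of_int q * c x = of_int z)"
    using assms
  proof (induction S rule: finite_induct)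
    case empty
    then show ?case by (intro exI[of _ 1]) auto
  next
    case (insert x S)
    then obtain q :: int where q: "q > 0" "\<forall>x\<in>S. \<exists>z :: int. of_int q * c x = of_int z" by blast
    obtain a b where ab: "c x = of_int a / of_int b" "b > 0"
      by (metis quotient_of_div quotient_of_denom_pos surj_pair)
    have "\<exists>z :: int. of_int (q * b) * c y = of_int z" if "y \<in> insert x S" for y
    proof (cases "y = x")
      case True
      then show ?thesis using ab by (intro exI[of _ "q * a"]) simp
    next
      case False
      then have "y \<in> S" using \<open>y \<in> insert x S\<close> by simp
      then obtain z :: int where "of_int q * c y = of_int z" using q by blast
      then show ?thesis by (intro exI[of _ "z * b"]) (simp add: mult_ac)
    qed
    then show ?case using q ab by (intro exI[of _ "q * b"]) auto
  qed
  then show ?thesis using that by metis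
qed

text \<open>Straightened coordinates are additive on \<open>H\<close> with trivial kernel, so at
  least \<open>t + d\<close> independent elements give as many echelon pivots. At most
  \<open>t\<close> of these are central. Rows at the other pivots are isotropic, as combinations of
  projections of commuting elements.\<close>

lemma isotropic_of_abelian_subgroup:
  assumes \<Phi>: "\<Phi> \<in> form_tuples n t" and d: "d > 0"
    and has: "has_abelian_subgroup_of_rank (t + d) (form_group n t \<Phi>)"
  obtains S u where "isotropic_frame n t (rat_tuple \<Phi>) S u" "card S = d"
proof -
  let ?G = "form_group n t \<Phi>"
  obtain H where H: "subgroup H ?G" and comm: "comm_group (?G\<lparr>carrier := H\<rparr>)"
    and rk: "abelian_rank (?G\<lparr>carrier := H\<rparr>) = enat (t + d)"
    using has by (auto simp: has_abelian_subgroup_of_rank_def)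
  interpret H: comm_group "?G\<lparr>carrier := H\<rparr>" by fact
  have HG: "H \<subseteq> carrier ?G" using H by (rule subgroup.subset)
  \<comment> \<open>The rank is a supremum: if every independent set had at most
    \<open>t + d - 1\<close> elements, it would stay below \<open>t + d\<close>.\<close>
  obtain X where X: "int_independent (?G\<lparr>carrier := H\<rparr>) X" "t + d \<le> card X"
  proof (rule ccontr)
    assume "\<not> thesis"
    then have "abelian_rank (?G\<lparr>carrier := H\<rparr>) \<le> enat (t + d - 1)"
      unfolding abelian_rank_def using that d by (intro SUP_least) force
    then show False using rk d by simp
  qed
  have XH: "finite X" "X \<subseteq> H" using X by (auto simp: int_independent_def)
  have commute: "x \<otimes>\<^bsub>?G\<^esub> y = y \<otimes>\<^bsub>?G\<^esub> x" if "x \<in> H" "y \<in> H" for x y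
    using H.m_comm[of x y] that by simp
  define B where "B = Inl ` {..<n} \<union> Inr ` {..<t :: nat}"
  have add: "straightened_coord n \<Phi> (x \<otimes>\<^bsub>?G\<lparr>carrier := H\<rparr>\<^esub> y) b =
      straightened_coord n \<Phi> x b + straightened_coord n \<Phi> y b"
    if "b \<in> B" "x \<in> carrier (?G\<lparr>carrier := H\<rparr>)" "y \<in> carrier (?G\<lparr>carrier := H\<rparr>)" for x y b
  proof -
    have xy: "x \<in> H" "y \<in> H" using that by simp_all
    then show ?thesis
      using straightened_coord_mult[OF \<Phi> that(1)[unfolded B_def] subsetD[OF HG] subsetD[OF HG] commute]
      by simp
  qed
  have indep_int: "c x = 0"
    if c: "\<forall>b\<in>B. (\<Sum>x\<in>X. c x * straightened_coord n \<Phi> x b) = 0" and x: "x \<in> X" for c x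
  proof -
    let ?p = "\<Otimes>\<^bsub>?G\<lparr>carrier := H\<rparr>\<^esub>x\<in>X. x [^]\<^bsub>?G\<lparr>carrier := H\<rparr>\<^esub> c x"
    have "?p \<in> carrier (?G\<lparr>carrier := H\<rparr>)"
      using XH by (intro H.finprod_closed Pi_I H.int_pow_closed) auto
    then have "?p \<in> carrier ?G" using HG by auto
    moreover have "straightened_coord n \<Phi> ?p b = 0" if "b \<in> B" for b
      using H.additive_finprod_int_pow[of "\<lambda>x. straightened_coord n \<Phi> x b" X c] add that XH c
      by simp
    ultimately have "?p = \<one>\<^bsub>?G\<^esub>"
      by (intro straightened_coord_eq_0) (auto simp: B_def)
    then show ?thesis using X(1) x by (auto simp: int_independent_def)
  qed
  define v :: "int vec \<times> int vec \<Rightarrow> nat + nat \<Rightarrow> rat"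
    where "v x b = of_int (straightened_coord n \<Phi> x b)" for x b
  \<comment> \<open>Independence over the integers passes to the rationals by clearing
    denominators.\<close>
  have "c x = 0" if c: "\<forall>b\<in>B. (\<Sum>x\<in>X. c x * v x b) = 0" and x: "x \<in> X" for c x
  proof -
    obtain q and c' :: "_ \<Rightarrow> int" where q: "q > 0" "\<And>x. x \<in> X \<Longrightarrow> of_int q * c x = of_int (c' x)"
      using ex_common_denominator[OF XH(1)] by blast
    have "(\<Sum>x\<in>X. c' x * straightened_coord n \<Phi> x b) = 0" if "b \<in> B" for b
    proof -
      have "of_int (\<Sum>x\<in>X. c' x * straightened_coord n \<Phi> x b) = (\<Sum>x\<in>X. (of_int q * c x) * v x b)"
        by (simp add: v_def q)
      also have "\<dots> = of_int q * (\<Sum>x\<in>X. c x * v x b)"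
        by (simp add: sum_distrib_left mult.assoc)
      also have "\<dots> = 0" using c that by simp
      finally show ?thesis by (simp only: of_int_eq_0_iff)
    qed
    then have "c' x = 0" using indep_int x by blast
    then show ?thesis using q(1) q(2)[OF x] by simp
  qed
  then have "\<forall>c. (\<forall>b\<in>B. (\<Sum>x\<in>X. c x * v x b) = 0) \<longrightarrow> (\<forall>x\<in>X. c x = 0)"
    by blast
  from ex_reduced_echelon[OF XH(1) this] obtain P w where P: "P \<subseteq> B" "finite P" "card P = card X"
    and w: "\<And>s s'. s \<in> P \<Longrightarrow> s' \<in> P \<Longrightarrow> (\<Sum>x\<in>X. w s x * v x s') = of_bool (s = s')"
    by blast
  define S\<^sub>0 where "S\<^sub>0 = {i. Inl i \<in> P}"
  have S0: "S\<^sub>0 \<subseteq> {..<n}" using P by (auto simp: S\<^sub>0_def B_def)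
  have "card P \<le> card (Inl ` S\<^sub>0 \<union> Inr ` {..<t} :: (nat + nat) set)"
    using P S0 finite_subset[OF S0] by (intro card_mono) (auto simp: S\<^sub>0_def B_def)
  also have "\<dots> \<le> card S\<^sub>0 + t"
    by (rule order_trans[OF card_Un_le])
      (use card_image_le[of S\<^sub>0 Inl] card_image_le[of "{..<t}" Inr] finite_subset[OF S0] in
        \<open>auto intro: add_mono\<close>)
  finally have "d \<le> card S\<^sub>0" using P X by simp
  then obtain S where S: "S \<subseteq> S\<^sub>0" "card S = d"
    by (meson obtain_subset_with_card_n)
  \<comment> \<open>The non-central part of the echelon row with pivot \<open>Inl s\<close>.\<close>
  define u where "u s j = (\<Sum>x\<in>X. w (Inl s) x * of_int (fst x $ j))" for s j
  have "isotropic_frame n t (rat_tuple \<Phi>) S u"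
    unfolding isotropic_frame_def
  proof (intro conjI ballI allI impI)
    show "S \<subseteq> {..<n}" using S S0 by auto
    show "u s s' = of_bool (s = s')" if "s \<in> S" "s' \<in> S" for s s'
    proof -
      have "Inl s \<in> P" "Inl s' \<in> P" using that S by (auto simp: S\<^sub>0_def)
      from w[OF this] show ?thesis by (simp add: u_def v_def straightened_coord_def)
    qed
    show "form_value n (rat_tuple \<Phi> ! m) (u s) (u s') = 0" if "m < t" "s \<in> S" "s' \<in> S" for m s s'
    proof -
      have \<Phi>m: "\<Phi> ! m \<in> carrier_mat n n" "m < length \<Phi>"
        using \<Phi> that by (auto simp: form_tuples_def alternating_forms_def subset_iff)
      have "form_value n (rat_tuple \<Phi> ! m) (\<lambda>j. of_int (fst x $ j)) (\<lambda>j. of_int (fst y $ j)) = 0"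
        if "x \<in> X" "y \<in> X" for x y
      proof -
        have "form_value n (rat_tuple \<Phi> ! m) (\<lambda>j. of_int (fst x $ j)) (\<lambda>j. of_int (fst y $ j)) =
            of_int (form_value n (\<Phi> ! m) (($) (fst x)) (($) (fst y)))"
          using \<Phi>m by (simp add: form_value_def rat_tuple_def)
        also have "\<dots> = 0"
          using form_group_commute(1)[OF \<Phi> \<open>m < t\<close> commute] XH that by (simp add: subsetD)
        finally show ?thesis .
      qed
      then show ?thesis
        unfolding u_def[abs_def] form_value_sum by simp
    qed
  qed
  then show ?thesis using that S(2) by blast
qed

section \<open>Passage to the generic statement\<close>

lemma rat_tuple_in_form_tuples:
  assumes "\<Phi> \<in> form_tuples n t"
  shows "rat_tuple \<Phi> \<in> form_tuples n t"
proof -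
  have "map_mat of_int A \<in> (alternating_forms n :: rat mat set)" if "A \<in> alternating_forms n" for A :: "int mat"
  proof -
    have A: "A \<in> carrier_mat n n" "\<And>i j. i < n \<Longrightarrow> j < n \<Longrightarrow> A $$ (i, j) = - A $$ (j, i)"
      using that unfolding alternating_forms_iff by blast+
    have "(of_int (A $$ (i, j)) :: rat) = - of_int (A $$ (j, i))" if "i < n" "j < n" for i j
      using A(2)[OF that] by (metis of_int_minus)
    moreover have "map_mat of_int A \<in> (carrier_mat n n :: rat mat set)" using A(1) by simp
    ultimately show ?thesis
      unfolding alternating_forms_iff using A(1) by (metis carrier_matD index_map_mat(1))
  qed
  with assms show ?thesis by (auto simp: form_tuples_def rat_tuple_def)
qed

theorem theorem2:
  fixes n t :: nat
  assumes "n > 0" and "t > 0"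
  shows "generic_group_has n t
           (\<lambda>G. \<not> has_abelian_subgroup_of_rank ((2 * n + t\<^sup>2 + 3 * t) div (t + 2) + 1) G)"
proof -
  \<comment> \<open>Splitting \<open>t * (t + 2)\<close> off the numerator in the statement leaves
    \<open>2 * n + t\<close>, so the rank there is \<open>t + d\<close>.\<close>
  define k where "k = (2 * n + t) div (t + 2)"
  define d where "d = k + 1"
  have "2 * n + t\<^sup>2 + 3 * t = (2 * n + t) + t * (t + 2)"
    by (simp add: power2_eq_square algebra_simps)
  also have "\<dots> div (t + 2) = t + k"
    unfolding k_def by (rule div_mult_self1) simp
  finally have r: "(2 * n + t\<^sup>2 + 3 * t) div (t + 2) + 1 = t + d"
    by (simp add: d_def)
  \<comment> \<open>\<open>d\<close> is the least natural number with \<open>d * (t + 2)\<close>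
    above \<open>2 * n + t\<close>, the strict inequality behind the dimension count.\<close>
  have "2 * n + t < (t + 2) + k * (t + 2)"
    unfolding k_def by (rule dividend_less_div_times) simp
  then have "2 * n + t < d * (t + 2)"
    by (simp add: d_def)
  then obtain f \<Phi>\<^sub>0 where f: "form_polynomial n t f" "\<Phi>\<^sub>0 \<in> form_tuples n t" "f \<Phi>\<^sub>0 \<noteq> 0"
    and vanish: "\<And>\<Phi> S u. \<Phi> \<in> form_tuples n t \<Longrightarrow> isotropic_frame n t \<Phi> S u \<Longrightarrow> card S = d \<Longrightarrow> f \<Phi> = 0"
    by (rule ex_form_polynomial_vanishing_on_isotropic) blast
  \<comment> \<open>A hypersurface, proper because \<open>f\<close> is nonzero at
    \<open>\<Phi>\<^sub>0\<close>.\<close>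
  let ?Z = "{\<Phi> \<in> form_tuples n t. f \<Phi> = 0}"
  have "zariski_closed n t ?Z"
    unfolding zariski_closed_def using f(1) by (intro exI[of _ "{f}"]) auto
  moreover have "?Z \<subset> form_tuples n t" using f(2,3) by blast
  moreover have "rat_tuple \<Phi> \<in> ?Z"
    if "\<Phi> \<in> indep_form_tuples n t" "has_abelian_subgroup_of_rank (t + d) (form_group n t \<Phi>)" for \<Phi>
  proof -
    have \<Phi>: "\<Phi> \<in> form_tuples n t" using that by (simp add: indep_form_tuples_def)
    have "d > 0" by (simp add: d_def)
    from isotropic_of_abelian_subgroup[OF \<Phi> this that(2)] obtain S u where
      "isotropic_frame n t (rat_tuple \<Phi>) S u" "card S = d"
      by blast
    with vanish rat_tuple_in_form_tuples[OF \<Phi>] show ?thesis by blast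
  qed
  ultimately show ?thesis
    unfolding generic_group_has_def r by (intro exI[of _ ?Z]) auto
qed

end
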